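(* Let $E_1,\dots,E_s\in\mathbb{C}^{n\times n}$ and let $T(x)=\sum_{i=1}^{s}t_i(x)E_i$ and $R^*(x)=\sum_{i=1}^{s}r_i^*(x)E_i$ for $x\in\bar\Omega$. Suppose that $\boldsymbol{\xi}^*(x)=[r_1^*(x),\dots,r_s^*(x)]^{\mathrm T}$ and $\boldsymbol{t}(x)=[t_1(x),\dots,t_s(x)]^{\mathrm T}$ satisfy $$\sup_{x\in\bar\Omega}\|\boldsymbol{t}(x)-\boldsymbol{\xi}^*(x)\|_2\le \epsilon .$$ Then $$\sup_{x\in\bar\Omega}\|T(x)-R^*(x)\|_{\mathrm F}\le \sqrt{\|\mathscr{G}\|_2}\;\epsilon ,$$ where $\mathscr{G}\in\mathbb{C}^{s\times s}$ is the matrix whose $(k,l)$ entry is $\mathrm{tr}(E_l^{\mathrm H}E_k)$.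
   Context: $\Omega\subset\mathbb{C}$ is a Jordan domain bounded by a simple Jordan curve $\Gamma=\partial\Omega$, and $\bar\Omega=\Omega\cup\Gamma$. Each $t_i:\bar\Omega\to\mathbb{C}$ is analytic in $\Omega$ and continuous on $\bar\Omega$. The functions $r_i^*(x)=p_i^*(x)/q^*(x)$, $i=1,\dots,s$, are rational functions with a common denominator polynomial $q^*\not\equiv 0$ and numerator polynomials $p_i^*$; the supremum hypothesis includes that they take finite values on $\bar\Omega$. $\|\cdot\|_2$ is the Euclidean norm of a vector or the spectral norm of a matrix, $\|\cdot\|_{\mathrm F}$ is the Frobenius norm, $\mathrm{tr}$ is the trace, and $E^{\mathrm H}$ is the conjugate transpose of $E$. *)

theory Defs
  imports
    "HOL-Analysis.Analysis"
    "HOL-Computational_Algebra.Computational_Algebra"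
    "HOL-Computational_Algebra.Field_as_Ring"
begin

section \<open>Jordan domains\<close>

definition jordan_curve :: "complex set \<Rightarrow> bool"
  where "jordan_curve C \<longleftrightarrow>
    (\<exists>\<gamma>. simple_path \<gamma> \<and> pathfinish \<gamma> = pathstart \<gamma> \<and> path_image \<gamma> = C)"

definition jordan_domain :: "complex set \<Rightarrow> bool"
  where "jordan_domain S \<longleftrightarrow> (\<exists>C. jordan_curve C \<and> S = inside C)"

lemma jordan_domainD:
  assumes "jordan_domain S"
  shows "open S" "connected S" "S \<noteq> {}" "bounded S" "jordan_curve (frontier S)"
    "S = inside (frontier S)"
proof -
  obtain c where c: "simple_path c" "pathfinish c = pathstart c" "S = inside (path_image c)"
    using assms unfolding jordan_domain_def jordan_curve_def by blast
  note * = Jordan_inside_outside[OF c(1,2)]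
  show "open S" "connected S" "S \<noteq> {}" "bounded S"
    using * c(3) by auto
  have F: "frontier S = path_image c"
    using * c(3) by auto
  show "jordan_curve (frontier S)"
    unfolding F jordan_curve_def using c by blast
  show "S = inside (frontier S)"
    using F c(3) by simp
qed


section \<open>Rational functions\<close>

text \<open>
  A rational function is an element of the field of fractions of \<open>complex poly\<close>. It is evaluated
  in lowest terms, so a common zero of a chosen numerator and denominator is not by itself a pole.
\<close>

definition ratfun_eval :: "complex poly fract \<Rightarrow> complex \<Rightarrow> complex"
  where "ratfun_eval r x = poly (fst (quot_of_fract r)) x / poly (snd (quot_of_fract r)) x"

definition ratfun_finite_at :: "complex poly fract \<Rightarrow> complex \<Rightarrow> bool"
  where "ratfun_finite_at r x \<longleftrightarrow> poly (snd (quot_of_fract r)) x \<noteq> 0"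

lemma ratfun_Fract:
  fixes p q :: "complex poly"
  assumes "poly q x \<noteq> 0"
  shows "ratfun_finite_at (Fract p q) x" "ratfun_eval (Fract p q) x = poly p x / poly q x"
proof -
  define a b where "a = fst (quot_of_fract (Fract p q))" and "b = snd (quot_of_fract (Fract p q))"
  have q0: "q \<noteq> 0" using assms by auto
  have b0: "b \<noteq> 0" by (simp add: b_def)
  have "Fract a b = Fract p q" by (simp add: a_def b_def)
  then have eq: "a * q = p * b" using q0 b0 by (simp add: eq_fract)
  have cop: "coprime a b" unfolding a_def b_def by (rule coprime_quot_of_fract)
  have "b dvd a * q" using eq by simp
  then have "b dvd q" using cop by (simp add: coprime_commute coprime_dvd_mult_right_iff)
  then have bx: "poly b x \<noteq> 0" using assms by (auto elim!: dvdE)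
  then show "ratfun_finite_at (Fract p q) x" by (simp add: ratfun_finite_at_def b_def)
  have "poly a x * poly q x = poly p x * poly b x"
    using eq by (metis poly_mult)
  then show "ratfun_eval (Fract p q) x = poly p x / poly q x"
    using bx assms by (simp add: ratfun_eval_def a_def b_def field_simps)
qed


section \<open>Matrices\<close>

definition conj_transpose :: "complex^'n^'m \<Rightarrow> complex^'m^'n"
  where "conj_transpose A = (\<chi> i j. cnj (A $ j $ i))"

definition mat_scale :: "complex \<Rightarrow> complex^'n^'m \<Rightarrow> complex^'n^'m"
  where "mat_scale c A = (\<chi> i j. c * A $ i $ j)"

definition frobenius_norm :: "complex^'n^'m \<Rightarrow> real"
  where "frobenius_norm A = sqrt (\<Sum>i\<in>UNIV. \<Sum>j\<in>UNIV. (cmod (A $ i $ j))\<^sup>2)"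

text \<open>The library norm on \<open>complex^'n\<close> is the Euclidean one, so this is the spectral norm.\<close>

definition spectral_norm :: "complex^'n^'m \<Rightarrow> real"
  where "spectral_norm A = onorm (\<lambda>v. A *v v)"

definition gram_matrix :: "('s \<Rightarrow> complex^'n^'n) \<Rightarrow> complex^'s^'s"
  where "gram_matrix E = (\<chi> k l. trace (conj_transpose (E l) ** E k))"

end

theory Submission
  imports Defs
begin

text \<open>
  The error \<open>T x - R x\<close> is the combination of the matrices \<open>E i\<close> whose coefficient vector \<open>d\<close> is
  the difference of \<open>tvec x\<close> and \<open>\<xi> x\<close>. The squared Frobenius norm comes from the inner product
  \<open>(A, B) \<mapsto> trace (conj_transpose B ** A)\<close>, so for such a combination it is the quadratic form
  of the Gram matrix at \<open>d\<close> (\<open>frobenius_norm_combination_gram\<close>). The Cauchy--Schwarz inequality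
  and the definition of the spectral norm bound this form by the spectral norm times the square of
  the norm of \<open>d\<close>; taking square roots gives the estimate at each point separately
  (\<open>frobenius_norm_combination_le\<close>), and the supremum inherits it.
\<close>

lemma trace_conj_transpose_mult:
  fixes A B :: "complex^'n^'m"
  shows "trace (conj_transpose B ** A) = (\<Sum>i\<in>UNIV. \<Sum>j\<in>UNIV. cnj (B $ i $ j) * A $ i $ j)"
  unfolding trace_def matrix_matrix_mult_def conj_transpose_def
  by (simp, rule sum.swap)

lemma frobenius_norm_power2_trace:
  fixes A :: "complex^'n^'m"
  shows "of_real ((frobenius_norm A)\<^sup>2) = trace (conj_transpose A ** A)"
proof -
  have "0 \<le> (\<Sum>i\<in>UNIV. \<Sum>j\<in>UNIV. (cmod (A $ i $ j))\<^sup>2)"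
    by (intro sum_nonneg) simp
  then show ?thesis
    by (simp add: frobenius_norm_def trace_conj_transpose_mult complex_norm_square mult.commute
        del: of_real_power)
qed

lemma matrix_vector_mult_norm_le_spectral:
  fixes A :: "complex^'n^'m"
  shows "norm (A *v v) \<le> spectral_norm A * norm v"
  unfolding spectral_norm_def
  by (rule onorm) (rule matrix_vector_mul_bounded_linear)

lemma spectral_norm_nonneg: "0 \<le> spectral_norm (A :: complex^'n^'m)"
  unfolding spectral_norm_def
  by (rule onorm_pos_le) (rule matrix_vector_mul_bounded_linear)

lemma norm_sum_mult_le:
  fixes v w :: "complex^'s"
  shows "cmod (\<Sum>k\<in>UNIV. v $ k * w $ k) \<le> norm v * norm w"
proof -
  have "cmod (\<Sum>k\<in>UNIV. v $ k * w $ k) \<le> (\<Sum>k\<in>UNIV. cmod (v $ k) * cmod (w $ k))"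
    by (rule sum_norm_le) (simp add: norm_mult)
  also have "\<dots> \<le> norm v * norm w"
    unfolding norm_vec_def using L2_set_mult_ineq[of "\<lambda>k. cmod (v $ k)" "\<lambda>k. cmod (w $ k)" UNIV]
    by simp
  finally show ?thesis .
qed

text \<open>
  Expanding both factors of the trace form by sesquilinearity produces the entry of the Gram matrix
  at \<open>(k, l)\<close> with weight \<open>d $ k * cnj (d $ l)\<close>. The conjugated coefficients belong to the column
  index, so the matrix acts on the conjugate of \<open>d\<close>.
\<close>

lemma frobenius_norm_combination_gram:
  fixes d :: "complex^'s" and E :: "'s \<Rightarrow> complex^'n^'n"
  shows "of_real ((frobenius_norm (\<Sum>i\<in>UNIV. mat_scale (d $ i) (E i)))\<^sup>2)
    = (\<Sum>k\<in>UNIV. d $ k * (gram_matrix E *v (\<chi> l. cnj (d $ l))) $ k)"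
proof -
  let ?e = "\<lambda>i j k l. cnj (d $ l * E l $ i $ j) * (d $ k * E k $ i $ j)"
  have "of_real ((frobenius_norm (\<Sum>i\<in>UNIV. mat_scale (d $ i) (E i)))\<^sup>2)
      = (\<Sum>i\<in>UNIV. \<Sum>j\<in>UNIV. \<Sum>k\<in>UNIV. \<Sum>l\<in>UNIV. ?e i j k l)"
    unfolding frobenius_norm_power2_trace trace_conj_transpose_mult
    by (simp only: sum_component mat_scale_def vec_lambda_beta cnj_sum sum_product)
       (intro sum.cong refl sum.swap)
  also have "\<dots> = (\<Sum>i\<in>UNIV. \<Sum>k\<in>UNIV. \<Sum>j\<in>UNIV. \<Sum>l\<in>UNIV. ?e i j k l)"
    by (intro sum.cong refl sum.swap)
  also have "\<dots> = (\<Sum>k\<in>UNIV. \<Sum>i\<in>UNIV. \<Sum>j\<in>UNIV. \<Sum>l\<in>UNIV. ?e i j k l)"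
    by (rule sum.swap)
  also have "\<dots> = (\<Sum>k\<in>UNIV. \<Sum>i\<in>UNIV. \<Sum>l\<in>UNIV. \<Sum>j\<in>UNIV. ?e i j k l)"
    by (intro sum.cong refl sum.swap)
  also have "\<dots> = (\<Sum>k\<in>UNIV. \<Sum>l\<in>UNIV. \<Sum>i\<in>UNIV. \<Sum>j\<in>UNIV. ?e i j k l)"
    by (intro sum.cong refl sum.swap)
  also have "\<dots> = (\<Sum>k\<in>UNIV. d $ k * (gram_matrix E *v (\<chi> l. cnj (d $ l))) $ k)"
    by (simp add: gram_matrix_def matrix_vector_mult_def trace_conj_transpose_mult
        sum_distrib_left sum_distrib_right mult_ac)
  finally show ?thesis .
qed

lemma frobenius_norm_combination_le:
  fixes d :: "complex^'s" and E :: "'s \<Rightarrow> complex^'n^'n"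
  shows "frobenius_norm (\<Sum>i\<in>UNIV. mat_scale (d $ i) (E i))
    \<le> sqrt (spectral_norm (gram_matrix E)) * norm d"
proof -
  let ?F = "frobenius_norm (\<Sum>i\<in>UNIV. mat_scale (d $ i) (E i))"
  let ?c = "\<chi> l. cnj (d $ l)"
  have norm_c: "norm ?c = norm d"
    by (simp add: norm_vec_def)
  have "?F\<^sup>2 = cmod (of_real (?F\<^sup>2))"
    unfolding norm_of_real by simp
  also have "\<dots> = cmod (\<Sum>k\<in>UNIV. d $ k * (gram_matrix E *v ?c) $ k)"
    unfolding frobenius_norm_combination_gram ..
  also have "\<dots> \<le> norm d * norm (gram_matrix E *v ?c)"
    by (rule norm_sum_mult_le)
  also have "\<dots> \<le> norm d * (spectral_norm (gram_matrix E) * norm d)"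
    using matrix_vector_mult_norm_le_spectral[of "gram_matrix E" ?c]
    by (intro mult_left_mono) (simp_all add: norm_c)
  also have "\<dots> = (sqrt (spectral_norm (gram_matrix E)) * norm d)\<^sup>2"
    by (simp add: power_mult_distrib spectral_norm_nonneg power2_eq_square[of "norm d"])
  finally show ?thesis
    by (rule power2_le_imp_le) (simp add: spectral_norm_nonneg)
qed

theorem theorem3p1:
  fixes \<Omega> :: "complex set"
    and t :: "'s::finite \<Rightarrow> complex \<Rightarrow> complex"
    and p :: "'s \<Rightarrow> complex poly"
    and q :: "complex poly"
    and r :: "'s \<Rightarrow> complex poly fract"
    and E :: "'s \<Rightarrow> complex^'n^'n"
    and T R :: "complex \<Rightarrow> complex^'n^'n"
    and \<xi> tvec :: "complex \<Rightarrow> complex^'s"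
    and \<epsilon> :: real
  assumes "jordan_domain \<Omega>"
    and "\<And>i. t i analytic_on \<Omega>"
    and "\<And>i. continuous_on (closure \<Omega>) (t i)"
    and "q \<noteq> 0"
    and "\<And>i. r i = Fract (p i) q"
    and "\<And>i x. x \<in> closure \<Omega> \<Longrightarrow> ratfun_finite_at (r i) x"
    and "\<And>x. x \<in> closure \<Omega> \<Longrightarrow> T x = (\<Sum>i\<in>UNIV. mat_scale (t i x) (E i))"
    and "\<And>x. x \<in> closure \<Omega> \<Longrightarrow> R x = (\<Sum>i\<in>UNIV. mat_scale (ratfun_eval (r i) x) (E i))"
    and "\<And>x. x \<in> closure \<Omega> \<Longrightarrow> \<xi> x = (\<chi> i. ratfun_eval (r i) x)"
    and "\<And>x. x \<in> closure \<Omega> \<Longrightarrow> tvec x = (\<chi> i. t i x)"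
    and "(SUP x\<in>closure \<Omega>. ereal (norm (tvec x - \<xi> x))) \<le> ereal \<epsilon>"
  shows "(SUP x\<in>closure \<Omega>. ereal (frobenius_norm (T x - R x)))
    \<le> ereal (sqrt (spectral_norm (gram_matrix E)) * \<epsilon>)"
proof (rule SUP_least)
  fix x assume x: "x \<in> closure \<Omega>"
  let ?d = "tvec x - \<xi> x"
  have "ereal (norm ?d) \<le> ereal \<epsilon>"
    using assms(11) x by (meson SUP_upper order_trans)
  then have d: "norm ?d \<le> \<epsilon>"
    by simp
  have "T x - R x = (\<Sum>i\<in>UNIV. mat_scale (?d $ i) (E i))"
    using assms(7-10)[OF x]
    by (simp add: mat_scale_def vec_eq_iff algebra_simps flip: sum_subtractf)
  then have "frobenius_norm (T x - R x) \<le> sqrt (spectral_norm (gram_matrix E)) * norm ?d"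
    using frobenius_norm_combination_le[of ?d E] by simp
  also have "\<dots> \<le> sqrt (spectral_norm (gram_matrix E)) * \<epsilon>"
    using d by (intro mult_left_mono) (simp_all add: spectral_norm_nonneg)
  finally show "ereal (frobenius_norm (T x - R x))
      \<le> ereal (sqrt (spectral_norm (gram_matrix E)) * \<epsilon>)"
    by simp
qed

end
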